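(* Let $k\ge 0$ be an integer. For all integers $n\geq 0$, $$B_{n+k+1,k}(x)=\sum_{i=1}^{k+1}\binom{k+1}{i}(x-1)^{i-1}B_{n+k+1-i,k}(x),$$ with initial conditions $B_{i,k}(x)=B_i(x)$ for $0\leq i\leq k$. Consequently, as formal power series in $z$, $$\sum_{n\geq 0}B_{n,k}(x)z^n=\frac{1+\sum_{t=1}^k\left(B_t(x)-\sum_{i=1}^t\binom{k+1}{i}(x-1)^{i-1}B_{t-i}(x)\right)z^t}{1-\sum_{i=1}^{k+1}\binom{k+1}{i}z^i(x-1)^{i-1}}.$$
   Context: For integers $a,b$ write $[a,b]=\{a,a+1,\dots,b\}$ (empty if $a>b$) and $[n]=[1,n]$. $B_n$ denotes the group of signed permutations: bijections $\pi$ of $[-n,n]$ with $\pi(-i)=-\pi(i)$ (so $\pi(0)=0$), written in one-line notation $\pi=\pi(1),\dots,\pi(n)$; $B_0$ consists of the single empty signed permutation. The type B descent number is $\mathrm{des}_B(\pi)=|\{i\in[0,n-1]:\pi(i)>\pi(i+1)\}|$, with $\pi(0)=0$. The type B maximum drop of $\pi\in B_n$ is $$\mathrm{maxdrop}_B(\pi)=\max\Big\{\max\{i-\pi(i): i\in[n],\ \pi(i)>0\},\ \max\{i: i\in[n],\ \pi(i)<0\}\Big\},$$ where an empty inner maximum is disregarded, and the value is $0$ for $n=0$. Define $\mathcal{B}_{n,k}=\{\pi\in B_n:\mathrm{maxdrop}_B(\pi)\le k\}$, $B_{n,k}(x)=\sum_{\pi\in\mathcal{B}_{n,k}}x^{\mathrm{des}_B(\pi)}$,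 and the type B Eulerian polynomial $B_n(x)=\sum_{\pi\in B_n}x^{\mathrm{des}_B(\pi)}$ (so $B_0(x)=1$). *)

theory Defs
  imports "HOL-Computational_Algebra.Computational_Algebra" "HOL-Combinatorics.Permutations"
begin

(* permutes makes a signed permutation the identity outside [-n, n]; this fixes a unique
   representative for each bijection of [-n, n]. *)
definition signed_perms :: "nat \<Rightarrow> (int \<Rightarrow> int) set" where
  "signed_perms n =
     {\<pi>. \<pi> permutes {- int n..int n} \<and> (\<forall>i\<in>{- int n..int n}. \<pi> (- i) = - \<pi> i)}"

definition des_B :: "nat \<Rightarrow> (int \<Rightarrow> int) \<Rightarrow> nat" where
  "des_B n \<pi> = card {i \<in> {0..int n - 1}. \<pi> i > \<pi> (i + 1)}"

(* Taking the maximum of the union of the two sets is what disregards an empty inner maximum: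
   for n > 0 the union is nonempty, although either set alone may be empty. *)
definition maxdrop_B :: "nat \<Rightarrow> (int \<Rightarrow> int) \<Rightarrow> int" where
  "maxdrop_B n \<pi> =
     (if n = 0 then 0
      else Max ({i - \<pi> i | i. i \<in> {1..int n} \<and> \<pi> i > 0} \<union> {i. i \<in> {1..int n} \<and> \<pi> i < 0}))"

definition signed_perms_maxdrop :: "nat \<Rightarrow> nat \<Rightarrow> (int \<Rightarrow> int) set" where
  "signed_perms_maxdrop n k = {\<pi> \<in> signed_perms n. maxdrop_B n \<pi> \<le> int k}"

definition eulerian_B :: "nat \<Rightarrow> int poly" where
  "eulerian_B n = (\<Sum>\<pi>\<in>signed_perms n. monom 1 (des_B n \<pi>))"

definition eulerian_B_maxdrop :: "nat \<Rightarrow> nat \<Rightarrow> int poly" where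
  "eulerian_B_maxdrop n k = (\<Sum>\<pi>\<in>signed_perms_maxdrop n k. monom 1 (des_B n \<pi>))"

(* The quotient in the ring of formal power series over a commutative ring, for a denominator
   with constant term 1 (division of fps in the library needs a field of coefficients). *)
definition fps_quotient :: "'a::comm_ring_1 fps \<Rightarrow> 'a fps \<Rightarrow> 'a fps" where
  "fps_quotient f g = f * fps_right_inverse g 1"

lemma fps_quotient_unique:
  fixes f g h :: "'a::comm_ring_1 fps"
  assumes "fps_nth g 0 = 1"
  shows "h = fps_quotient f g \<longleftrightarrow> h * g = f"
proof -
  have inv: "g * fps_right_inverse g 1 = 1"
    using assms by (intro fps_right_inverse) simp
  show ?thesis
  proof
    assume "h = fps_quotient f g"
    then have "h * g = f * (g * fps_right_inverse g 1)"
      by (simp add: fps_quotient_def mult_ac)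
    then show "h * g = f"
      by (simp add: inv)
  next
    assume "h * g = f"
    then have "fps_quotient f g = h * (g * fps_right_inverse g 1)"
      by (auto simp: fps_quotient_def mult.assoc)
    then show "h = fps_quotient f g"
      by (simp add: inv)
  qed
qed

end

theory Submission imports Defs begin

text \<open>
  Fix \<open>n > k\<close> and mark some of the descents of a permutation, each mark having weight \<open>x - 1\<close>.
  If the last maximal run of marked positions covers the last \<open>i\<close> entries, these entries decrease to
  \<open>\<pi> n \<ge> n - k\<close>, so they form an arbitrary \<open>i\<close>-subset of the \<open>k + 1\<close> numbers \<open>n - k, \<dots>, n\<close>.
  Standardizing the other entries gives an arbitrary permutation of size \<open>n - i\<close> with maximum drop at
  most \<open>k\<close>, because only entries \<open>\<ge> n - k\<close> change and they remain \<open>\<ge> n - k\<close>.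
  The subset is counted by removing the last entry repeatedly, with the hockey-stick identity.
\<close>

section \<open>Signed permutations and the drop bound entry by entry\<close>

lemma signed_perms_nonzero:
  assumes "\<pi> \<in> signed_perms n" "i \<noteq> 0"
  shows "\<pi> i \<noteq> 0"
proof -
  have "inj \<pi>" using assms(1) by (auto simp: signed_perms_def dest: permutes_inj)
  moreover have "\<forall>i\<in>{- int n..int n}. \<pi> (- i) = - \<pi> i"
    using assms(1) by (simp add: signed_perms_def)
  then have "\<pi> (- 0) = - \<pi> 0" by (rule bspec) simp
  then have "\<pi> 0 = - \<pi> 0" by (simp only: minus_zero)
  then have "\<pi> 0 = 0" by linarith
  ultimately show ?thesis using assms(2) by (metis injD)
qed

text \<open>For \<open>n > 0\<close> the entry \<open>\<pi> 1\<close> is nonzero, so it contributes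
  to one of the two sets; hence \<open>Max\<close> is taken over a nonempty finite set and can be
  bounded elementwise.\<close>

lemma maxdrop_B_le_iff:
  "maxdrop_B n \<pi> \<le> int k \<longleftrightarrow>
     (\<forall>i\<in>{1..int n}. (\<pi> i > 0 \<longrightarrow> i - \<pi> i \<le> int k) \<and> (\<pi> i < 0 \<longrightarrow> i \<le> int k))"
  if "\<pi> \<in> signed_perms n"
proof (cases "n = 0")
  case True
  then show ?thesis by (simp add: maxdrop_B_def)
next
  case False
  let ?A = "{i - \<pi> i | i. i \<in> {1..int n} \<and> \<pi> i > 0}"
  let ?B = "{i. i \<in> {1..int n} \<and> \<pi> i < 0}"
  have "?A \<union> ?B \<subseteq> (\<lambda>i. i - \<pi> i) ` {1..int n} \<union> {1..int n}" by auto
  then have fin: "finite (?A \<union> ?B)" by (rule finite_subset) simp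
  have "\<pi> 1 \<noteq> 0" using that by (rule signed_perms_nonzero) simp
  then have "1 - \<pi> 1 \<in> ?A \<or> 1 \<in> ?B" using False by force
  then have "?A \<union> ?B \<noteq> {}" by blast
  then have "Max (?A \<union> ?B) \<le> int k \<longleftrightarrow> (\<forall>a\<in>?A \<union> ?B. a \<le> int k)"
    using fin by (rule Max_le_iff[rotated])
  also have "\<dots> \<longleftrightarrow> (\<forall>i\<in>{1..int n}. (\<pi> i > 0 \<longrightarrow> i - \<pi> i \<le> int k) \<and> (\<pi> i < 0 \<longrightarrow> i \<le> int k))"
    by blast
  finally show ?thesis using False by (simp add: maxdrop_B_def)
qed

lemma finite_signed_perms: "finite (signed_perms n)"
  by (rule finite_subset[of _ "{\<pi>. \<pi> permutes {- int n..int n}}"])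
    (auto simp: signed_perms_def finite_permutations)

lemma mem_signed_perms_maxdrop_iff:
  "\<pi> \<in> signed_perms_maxdrop n k \<longleftrightarrow> \<pi> \<in> signed_perms n \<and>
     (\<forall>i\<in>{1..int n}. (\<pi> i > 0 \<longrightarrow> i - \<pi> i \<le> int k) \<and> (\<pi> i < 0 \<longrightarrow> i \<le> int k))"
  using maxdrop_B_le_iff by (auto simp: signed_perms_maxdrop_def)

lemma finite_signed_perms_maxdrop: "finite (signed_perms_maxdrop n k)"
  using finite_signed_perms by (simp add: signed_perms_maxdrop_def)

lemma signed_perms_range:
  assumes "\<pi> \<in> signed_perms n" "\<bar>i\<bar> \<le> int n"
  shows "\<bar>\<pi> i\<bar> \<le> int n"
proof -
  have "\<pi> i \<in> {- int n..int n}"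
    using assms permutes_in_image[of \<pi> "{- int n..int n}" i] by (auto simp: signed_perms_def)
  then show ?thesis by auto
qed

lemma signed_perms_maxdrop_small:
  assumes "n \<le> k"
  shows "signed_perms_maxdrop n k = signed_perms n"
  using assms by (fastforce simp: mem_signed_perms_maxdrop_iff)

lemma signed_perms_comp:
  assumes "\<pi> \<in> signed_perms n" "\<rho> \<in> signed_perms n"
  shows "\<pi> \<circ> \<rho> \<in> signed_perms n"
proof -
  have "\<rho> i \<in> {- int n..int n}" if "i \<in> {- int n..int n}" for i
    using signed_perms_range[OF assms(2), of i] that by (simp add: abs_le_iff)
  then show ?thesis
    using assms by (auto simp: signed_perms_def intro: permutes_compose)
qed

text \<open>Identity outside [-n, n] makes the group of size n the stabilizer of n + 1 in the next
  group, so permutations of both sizes can be composed in one group.\<close>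

lemma signed_perms_Suc_iff:
  "\<pi> \<in> signed_perms n \<longleftrightarrow> \<pi> \<in> signed_perms (Suc n) \<and> \<pi> (int n + 1) = int n + 1"
proof
  assume "\<pi> \<in> signed_perms n"
  then have p: "\<pi> permutes {- int n..int n}" and o: "\<forall>i\<in>{- int n..int n}. \<pi> (- i) = - \<pi> i"
    by (auto simp: signed_perms_def)
  have out: "\<pi> j = j" if "\<bar>j\<bar> > int n" for j
    using that by (intro permutes_not_in[OF p]) auto
  have "\<pi> (- j) = - \<pi> j" for j
    using o out[of j] out[of "- j"] by (cases "\<bar>j\<bar> \<le> int n") (auto simp: abs_le_iff)
  moreover have "\<pi> permutes {- int (Suc n)..int (Suc n)}"
    using p by (rule permutes_subset) auto
  ultimately show "\<pi> \<in> signed_perms (Suc n) \<and> \<pi> (int n + 1) = int n + 1"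
    using out by (auto simp: signed_perms_def)
next
  assume *: "\<pi> \<in> signed_perms (Suc n) \<and> \<pi> (int n + 1) = int n + 1"
  then have p: "\<pi> permutes {- int (Suc n)..int (Suc n)}"
    and o: "\<forall>i\<in>{- int (Suc n)..int (Suc n)}. \<pi> (- i) = - \<pi> i" by (auto simp: signed_perms_def)
  have neg: "\<pi> (- (int n + 1)) = - (int n + 1)"
    using * o[rule_format, of "int n + 1"] by auto
  have out: "\<pi> j = j" if "j \<notin> {- int n..int n}" for j
  proof -
    have "j \<notin> {- int (Suc n)..int (Suc n)} \<or> j = int n + 1 \<or> j = - (int n + 1)" using that by auto
    then show ?thesis using permutes_not_in[OF p] * neg by metis
  qed
  have "\<pi> permutes {- int n..int n}"
    using p out by (auto simp: permutes_def)
  then show "\<pi> \<in> signed_perms n" using o by (auto simp: signed_perms_def)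
qed

section \<open>Appending and deleting the last entry\<close>

text \<open>
  The signed permutation that sends \<open>n + 1\<close> to \<open>u\<close> and is increasing on \<open>[-n, n]\<close>: composing it
  with a signed permutation of size \<open>n\<close> appends \<open>u\<close> as last entry. Below, \<open>sgn_delete\<close> is its inverse.
\<close>
definition sgn_insert :: "nat \<Rightarrow> int \<Rightarrow> int \<Rightarrow> int" where
  "sgn_insert n u j = (if \<bar>j\<bar> > int n + 1 \<or> \<bar>j\<bar> < u then j else if \<bar>j\<bar> = int n + 1 then sgn j * u
     else j + sgn j)"

definition sgn_delete :: "nat \<Rightarrow> int \<Rightarrow> int \<Rightarrow> int" where
  "sgn_delete n u j = (if \<bar>j\<bar> > int n + 1 \<or> \<bar>j\<bar> < u then j else if \<bar>j\<bar> = u then sgn j * (int n + 1)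
     else j - sgn j)"

lemma sgn_insert_minus: "sgn_insert n u (- j) = - sgn_insert n u j"
  by (simp add: sgn_insert_def)

lemma sgn_delete_minus: "sgn_delete n u (- j) = - sgn_delete n u j"
  by (simp add: sgn_delete_def)

context
  fixes n :: nat and u :: int
  assumes u: "1 \<le> u" "u \<le> int n + 1"
begin

lemma sgn_insert_delete: "sgn_insert n u (sgn_delete n u j) = j"
proof -
  have nonneg: "sgn_insert n u (sgn_delete n u i) = i" if "i \<ge> 0" for i
    using that u by (cases "i > int n + 1 \<or> i < u"; cases "i = u") (auto simp: sgn_insert_def sgn_delete_def)
  show ?thesis
    using nonneg[of j] nonneg[of "- j"] by (cases "j \<ge> 0") (simp_all add: sgn_insert_minus sgn_delete_minus)
qed

lemma sgn_delete_insert: "sgn_delete n u (sgn_insert n u j) = j"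
proof -
  have nonneg: "sgn_delete n u (sgn_insert n u i) = i" if "i \<ge> 0" for i
    using that u by (cases "i > int n + 1 \<or> i < u"; cases "i = int n + 1") (auto simp: sgn_insert_def sgn_delete_def)
  show ?thesis
    using nonneg[of j] nonneg[of "- j"] by (cases "j \<ge> 0") (simp_all add: sgn_insert_minus sgn_delete_minus)
qed

lemma sgn_insert_signed_perms: "sgn_insert n u \<in> signed_perms (Suc n)"
proof -
  have "bij (sgn_insert n u)"
    by (rule bijI') (metis sgn_delete_insert, metis sgn_insert_delete)
  then have "sgn_insert n u permutes {- int (Suc n)..int (Suc n)}"
    unfolding permutes_def bij_iff by (auto simp: sgn_insert_def)
  then show ?thesis by (simp add: signed_perms_def sgn_insert_minus)
qed

lemma sgn_delete_signed_perms: "sgn_delete n u \<in> signed_perms (Suc n)"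
proof -
  have "bij (sgn_delete n u)"
    by (rule bijI') (metis sgn_insert_delete, metis sgn_delete_insert)
  then have "sgn_delete n u permutes {- int (Suc n)..int (Suc n)}"
    unfolding permutes_def bij_iff by (auto simp: sgn_delete_def)
  then show ?thesis by (simp add: signed_perms_def sgn_delete_minus)
qed

lemma sgn_insert_less_iff:
  assumes "\<bar>a\<bar> \<le> int n" "\<bar>b\<bar> \<le> int n"
  shows "sgn_insert n u a < sgn_insert n u b \<longleftrightarrow> a < b"
  using assms u by (auto simp: sgn_insert_def sgn_if abs_if split: if_splits)

text \<open>The new last entry \<open>u\<close> drops by n + 1 - u, at most k. Signs are kept, and a
  positive entry changes only if it is at least \<open>u\<close>; at positions up to n its drop is
  then at most k both before and after.\<close>

lemma sgn_insert_comp_maxdrop_iff: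
  assumes "\<rho> \<in> signed_perms n" "u + int k \<ge> int n + 1"
  shows "sgn_insert n u \<circ> \<rho> \<in> signed_perms_maxdrop (Suc n) k \<longleftrightarrow> \<rho> \<in> signed_perms_maxdrop n k"
proof -
  have s: "sgn_insert n u \<circ> \<rho> \<in> signed_perms (Suc n)"
    using assms(1) signed_perms_Suc_iff sgn_insert_signed_perms signed_perms_comp by blast
  have last: "\<rho> (int n + 1) = int n + 1" using assms(1) signed_perms_Suc_iff by blast
  have pos: "sgn_insert n u a > 0 \<longleftrightarrow> a > 0" "sgn_insert n u a < 0 \<longleftrightarrow> a < 0" for a
    using u by (auto simp: sgn_insert_def sgn_if)
  have bd: "i - sgn_insert n u a \<le> int k \<longleftrightarrow> i - a \<le> int k"
    if "a > 0" "a \<le> int n" "i \<le> int n" for a i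
    using that assms(2) u by (auto simp: sgn_insert_def sgn_if)
  have eq: "{1..int (Suc n)} = insert (int n + 1) {1..int n}" by auto
  have bnd: "\<rho> i \<le> int n" if "i \<in> {1..int n}" for i
    using signed_perms_range[OF assms(1), of i] that by auto
  have "sgn_insert n u (int n + 1) = u" using u by (auto simp: sgn_insert_def)
  then show ?thesis unfolding mem_signed_perms_maxdrop_iff eq
    using s assms u bnd by (auto simp: last pos bd)
qed

end

section \<open>Counting permutations with a decreasing end\<close>

text \<open>
  For \<open>i = n + 1\<close> the decreasing stretch starts at position \<open>0\<close>. The bound \<open>m\<close> on the last entry is
  what makes the induction in \<open>sum_decreasing_end\<close> go through: after deleting the last entry
  \<open>n - l\<close>, the new last entry must be among the \<open>l\<close> largest values.
\<close>
definition decreasing_end :: "nat \<Rightarrow> nat \<Rightarrow> nat \<Rightarrow> nat \<Rightarrow> (int \<Rightarrow> int) set" where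
  "decreasing_end k i n m = {\<pi> \<in> signed_perms_maxdrop n k.
     (\<forall>j\<in>{int n - int i + 1..int n - 1}. \<pi> j > \<pi> (j + 1)) \<and> (i > 0 \<longrightarrow> \<pi> (int n) \<ge> int n + 1 - int m)}"

lemma finite_decreasing_end: "finite (decreasing_end k i n m)"
  using finite_signed_perms_maxdrop by (simp add: decreasing_end_def)

text \<open>Appending the prescribed last entry is a bijection. It preserves the order of the
  earlier entries, hence their descents, and the new descent at position n amounts to the bound
  \<open>l\<close> on the old last entry.\<close>

lemma sum_decreasing_end_fixed_last:
  assumes "i \<le> n" "l < m" "m \<le> k + 1" "m \<le> n + 1"
  shows "(\<Sum>\<pi> | \<pi> \<in> decreasing_end k (Suc i) (Suc n) m \<and> \<pi> (int n + 1) = int n + 1 - int l.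
            monom (1::int) (des_B (n - i) \<pi>))
       = (\<Sum>\<rho>\<in>decreasing_end k i n l. monom 1 (des_B (n - i) \<rho>))"
proof -
  define u where "u = int n + 1 - int l"
  have u: "1 \<le> u" "u \<le> int n + 1" "u + int k \<ge> int n + 1"
    using assms by (auto simp: u_def)
  note ins = u(1,2)
  define f where "f = sgn_insert n u"
  have lastf: "f (int n + 1) = u" using u by (auto simp: f_def sgn_insert_def)
  \<comment> \<open>On [-n, n] the map \<open>f\<close> skips the value \<open>u\<close>: arguments
    from \<open>u\<close> on move strictly above it.\<close>
  have fu: "f b < u \<longleftrightarrow> b < u" "u < f b \<longleftrightarrow> u \<le> b" if "\<bar>b\<bar> \<le> int n" for b
    using that u by (auto simp: f_def sgn_insert_def sgn_if abs_if split: if_splits)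
  have key: "f \<circ> \<rho> \<in> decreasing_end k (Suc i) (Suc n) m \<longleftrightarrow> \<rho> \<in> decreasing_end k i n l"
    and des: "des_B (n - i) (f \<circ> \<rho>) = des_B (n - i) \<rho>"
    and last: "(f \<circ> \<rho>) (int n + 1) = u"
    if \<rho>: "\<rho> \<in> signed_perms n" for \<rho>
  proof -
    have lt: "f (\<rho> a) < f (\<rho> b) \<longleftrightarrow> \<rho> a < \<rho> b" if "\<bar>a\<bar> \<le> int n" "\<bar>b\<bar> \<le> int n" for a b
      unfolding f_def using sgn_insert_less_iff[OF ins] signed_perms_range[OF \<rho>] that by blast
    show last: "(f \<circ> \<rho>) (int n + 1) = u"
      using \<rho> signed_perms_Suc_iff[of \<rho> n] lastf by simp
    show "des_B (n - i) (f \<circ> \<rho>) = des_B (n - i) \<rho>"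
      unfolding des_B_def
      by (intro arg_cong[where f=card] Collect_cong conj_cong refl) (use lt in auto)
    have "(\<forall>j\<in>{int (Suc n) - int (Suc i) + 1..int (Suc n) - 1}. (f \<circ> \<rho>) j > (f \<circ> \<rho>) (j + 1))
       \<longleftrightarrow> (\<forall>j\<in>{int n - int i + 1..int n - 1}. \<rho> j > \<rho> (j + 1))
          \<and> (i > 0 \<longrightarrow> \<rho> (int n) \<ge> int n + 1 - int l)"
    proof (cases "i = 0")
      case True
      then show ?thesis by simp
    next
      case False
      then have "{int (Suc n) - int (Suc i) + 1..int (Suc n) - 1} = insert (int n) {int n - int i + 1..int n - 1}"
        by auto
      moreover have "(f \<circ> \<rho>) (int n) > (f \<circ> \<rho>) (int n + 1) \<longleftrightarrow> \<rho> (int n) \<ge> int n + 1 - int l"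
        unfolding last using fu[OF signed_perms_range[OF \<rho>, of "int n"]] by (auto simp: u_def)
      moreover have "(\<forall>j\<in>{int n - int i + 1..int n - 1}. (f \<circ> \<rho>) j > (f \<circ> \<rho>) (j + 1))
         \<longleftrightarrow> (\<forall>j\<in>{int n - int i + 1..int n - 1}. \<rho> j > \<rho> (j + 1))"
        using lt assms(1) by (intro ball_cong refl) auto
      ultimately show ?thesis using False by auto
    qed
    moreover have "(f \<circ> \<rho>) (int (Suc n)) \<ge> int (Suc n) + 1 - int m"
      using last assms(2) by (simp add: u_def add.commute)
    ultimately show "f \<circ> \<rho> \<in> decreasing_end k (Suc i) (Suc n) m \<longleftrightarrow> \<rho> \<in> decreasing_end k i n l"
      unfolding decreasing_end_def using sgn_insert_comp_maxdrop_iff[OF ins \<rho> u(3)] f_def by auto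
  qed
  define g where "g = sgn_delete n u"
  have fg: "f \<circ> (g \<circ> \<pi>) = \<pi>" and gf: "g \<circ> (f \<circ> \<pi>) = \<pi>" for \<pi>
    using sgn_insert_delete[OF ins] sgn_delete_insert[OF ins] by (auto simp: f_def g_def)
  \<comment> \<open>\<open>g\<close> returns the last entry \<open>u\<close> to n + 1, so the
    composition fixes n + 1 and belongs to the smaller group.\<close>
  have gs: "g \<circ> \<pi> \<in> signed_perms n"
    if "\<pi> \<in> decreasing_end k (Suc i) (Suc n) m" "\<pi> (int n + 1) = u" for \<pi>
  proof -
    have "g \<circ> \<pi> \<in> signed_perms (Suc n)"
      using that sgn_delete_signed_perms[OF ins] signed_perms_comp
      by (auto simp: g_def decreasing_end_def mem_signed_perms_maxdrop_iff)
    moreover have "g u = int n + 1" using u by (auto simp: g_def sgn_delete_def)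
    ultimately show ?thesis using signed_perms_Suc_iff[of "g \<circ> \<pi>" n] that(2) by simp
  qed
  have sp: "\<rho> \<in> signed_perms n" if "\<rho> \<in> decreasing_end k i n l" for \<rho>
    using that by (auto simp: decreasing_end_def mem_signed_perms_maxdrop_iff)
  show ?thesis unfolding u_def[symmetric]
  proof (rule sum.reindex_bij_witness[where i="\<lambda>\<rho>. f \<circ> \<rho>" and j="\<lambda>\<pi>. g \<circ> \<pi>"])
    fix \<pi> assume a: "\<pi> \<in> {\<pi> \<in> decreasing_end k (Suc i) (Suc n) m. \<pi> (int n + 1) = u}"
    show "f \<circ> (g \<circ> \<pi>) = \<pi>" by (rule fg)
    show "g \<circ> \<pi> \<in> decreasing_end k i n l" using a key[OF gs] by (auto simp: fg)
    show "monom 1 (des_B (n - i) (g \<circ> \<pi>)) = monom (1::int) (des_B (n - i) \<pi>)"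
      using a des[OF gs] by (auto simp: fg)
  qed (use key last sp gf in auto)
qed

lemma sum_decreasing_end:
  assumes "i \<le> n" "m \<le> k + 1" "m \<le> n"
  shows "(\<Sum>\<pi>\<in>decreasing_end k i n m. monom 1 (des_B (n - i) \<pi>))
       = of_nat (m choose i) * eulerian_B_maxdrop (n - i) k"
  using assms
proof (induction i arbitrary: n m)
  case 0
  then show ?case by (simp add: decreasing_end_def eulerian_B_maxdrop_def)
next
  case (Suc i)
  then obtain n' where n: "n = Suc n'" by (cases n) auto
  let ?D = "decreasing_end k (Suc i) n m"
  \<comment> \<open>The shortfall of the last entry from the largest value; it is never negative, so
    \<open>nat\<close> loses nothing.\<close>
  let ?h = "\<lambda>\<pi>. nat (int n' + 1 - \<pi> (int n' + 1))"
  have last: "\<pi> (int n' + 1) \<le> int n' + 1" "\<pi> (int n' + 1) \<ge> int n' + 2 - int m" if "\<pi> \<in> ?D" for \<pi>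
    using that signed_perms_range[of \<pi> n "int n"]
    by (auto simp: decreasing_end_def mem_signed_perms_maxdrop_iff n add.commute)
  then have h: "?h ` ?D \<subseteq> {..<m}" by force
  have "(\<Sum>\<pi>\<in>?D. monom (1::int) (des_B (n - Suc i) \<pi>))
      = (\<Sum>l<m. \<Sum>\<pi> | \<pi> \<in> ?D \<and> ?h \<pi> = l. monom 1 (des_B (n - Suc i) \<pi>))"
    by (rule sum.group[symmetric, OF finite_decreasing_end _ h]) simp
  also have "\<dots> = (\<Sum>l<m. \<Sum>\<pi> | \<pi> \<in> ?D \<and> \<pi> (int n' + 1) = int n' + 1 - int l. monom 1 (des_B (n - Suc i) \<pi>))"
  proof (intro sum.cong refl Collect_cong conj_cong)
    fix l \<pi> assume "\<pi> \<in> ?D"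
    then show "?h \<pi> = l \<longleftrightarrow> \<pi> (int n' + 1) = int n' + 1 - int l" using last(1)[of \<pi>] by auto
  qed
  also have "\<dots> = (\<Sum>l<m. of_nat (l choose i) * eulerian_B_maxdrop (n' - i) k)"
  proof (rule sum.cong[OF refl])
    fix l assume l: "l \<in> {..<m}"
    show "(\<Sum>\<pi> | \<pi> \<in> ?D \<and> \<pi> (int n' + 1) = int n' + 1 - int l. monom 1 (des_B (n - Suc i) \<pi>))
        = of_nat (l choose i) * eulerian_B_maxdrop (n' - i) k"
      using sum_decreasing_end_fixed_last[of i n' l m k] Suc.IH[of n' l] Suc.prems l by (simp add: n)
  qed
  also have "\<dots> = of_nat (\<Sum>l<m. l choose i) * eulerian_B_maxdrop (n' - i) k"
    by (simp add: sum_distrib_right)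
  also have "(\<Sum>l<m. l choose i) = m choose Suc i"
    by (induction m) auto
  finally show ?case by (simp add: n)
qed

text \<open>Going back from position n, the entries start at n - k or more and rise by at least 1 in
  each of k + 1 steps, which would force an entry above n. The last position reached, n - k - 1, may
  be 0.\<close>

lemma decreasing_end_empty:
  assumes "n \<ge> k + 1"
  shows "decreasing_end k (k + 2) n (k + 1) = {}"
proof -
  have False if "\<pi> \<in> decreasing_end k (k + 2) n (k + 1)" for \<pi>
  proof -
    have d: "\<pi> j > \<pi> (j + 1)" if "j \<in> {int n - int k - 1..int n - 1}" for j
      using that \<open>\<pi> \<in> _\<close> by (auto simp: decreasing_end_def)
    have l: "\<pi> (int n) \<ge> int n - int k" and s: "\<pi> \<in> signed_perms n"
      using that by (auto simp: decreasing_end_def mem_signed_perms_maxdrop_iff)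
    have "\<pi> (int n - int j) \<ge> int n - int k + int j" if "j \<le> k + 1" for j
      using that
    proof (induction j)
      case (Suc j)
      then show ?case using d[of "int n - int (Suc j)"] by auto
    qed (use l in simp)
    from this[of "k + 1"] have "\<pi> (int n - int (k + 1)) \<ge> int n + 1" by simp
    then show False using signed_perms_range[OF s, of "int n - int (k + 1)"] assms by auto
  qed
  then show ?thesis by blast
qed

section \<open>Marking descents and the recurrence\<close>

lemma des_B_Suc: "des_B (Suc n) \<pi> = des_B n \<pi> + (if \<pi> (int n) > \<pi> (int n + 1) then 1 else 0)"
proof -
  let ?D = "{i \<in> {0..int n - 1}. \<pi> i > \<pi> (i + 1)}"
  have "{0..int (Suc n) - 1} = insert (int n) {0..int n - 1}" by auto
  then have "{i \<in> {0..int (Suc n) - 1}. \<pi> i > \<pi> (i + 1)} =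
      (if \<pi> (int n) > \<pi> (int n + 1) then insert (int n) ?D else ?D)" by auto
  moreover have "finite ?D" by (rule finite_subset[of _ "{0..int n - 1}"]) auto
  moreover have "int n \<notin> ?D" by simp
  ultimately show ?thesis by (simp add: des_B_def del: mem_Collect_eq)
qed

text \<open>Write x = 1 + (x - 1) for a descent at position n - i: the summand 1 forgets it, while x
  - 1 marks it and lengthens the decreasing end by one. Here \<open>[:-1, 1:]\<close> is x -
  1.\<close>

lemma sum_decreasing_end_step:
  assumes "1 \<le> i" "i \<le> n"
  shows "(\<Sum>\<pi>\<in>decreasing_end k i n m. monom (1::int) (des_B (Suc n - i) \<pi>)) =
     (\<Sum>\<pi>\<in>decreasing_end k i n m. monom 1 (des_B (n - i) \<pi>)) +
     [:-1, 1:] * (\<Sum>\<pi>\<in>decreasing_end k (Suc i) n m. monom 1 (des_B (n - i) \<pi>))"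
proof -
  let ?c = "\<lambda>\<pi>::int \<Rightarrow> int. \<pi> (int (n - i)) > \<pi> (int (n - i) + 1)"
  have "{int n - int (Suc i) + 1..int n - 1} = insert (int (n - i)) {int n - int i + 1..int n - 1}"
    using assms by auto
  \<comment> \<open>Since \<open>1 \<le> i\<close>, the bound on the last entry is in force for both
    lengths; only the descent at n - i is added.\<close>
  then have eq: "decreasing_end k (Suc i) n m = decreasing_end k i n m \<inter> {\<pi>. ?c \<pi>}"
    using assms by (auto simp: decreasing_end_def)
  have "monom (1::int) (des_B (Suc n - i) \<pi>) =
      monom 1 (des_B (n - i) \<pi>) + (if ?c \<pi> then [:-1, 1:] * monom 1 (des_B (n - i) \<pi>) else 0)" for \<pi>
  proof -
    have "[:-1, 1:] = monom (1::int) 1 - 1" by (simp add: monom_Suc one_pCons)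
    then show ?thesis
      using assms by (simp add: Suc_diff_le des_B_Suc left_diff_distrib mult_monom)
  qed
  then show ?thesis
    by (simp add: eq sum.distrib sum_distrib_left sum.If_cases finite_decreasing_end)
qed

text \<open>Iterating the marking step peels off one term of the sum for each length of the
  decreasing end, until no permutation has an end of length k + 2.\<close>

lemma eulerian_B_maxdrop_recurrence:
  assumes "n \<ge> k + 1"
  shows "eulerian_B_maxdrop n k = (\<Sum>i = 1..k + 1. of_nat ((k + 1) choose i) * [:-1, 1:] ^ (i - 1)
            * eulerian_B_maxdrop (n - i) k)"
proof -
  \<comment> \<open>The exponent counts descents at positions 0 to n - i, just short of the
    decreasing end; for i = 1 these are all descents.\<close>
  define U where "U i = (\<Sum>\<pi>\<in>decreasing_end k i n (k + 1). monom (1::int) (des_B (Suc n - i) \<pi>))" for i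
  have step: "U i = of_nat ((k + 1) choose i) * eulerian_B_maxdrop (n - i) k + [:-1, 1:] * U (Suc i)"
    if "1 \<le> i" "i \<le> k + 1" for i
    using that assms sum_decreasing_end_step[of i n k "k + 1"] sum_decreasing_end[of i n "k + 1" k]
    by (simp add: U_def)
  have tele: "U 1 = (\<Sum>i = 1..j. of_nat ((k + 1) choose i) * [:-1, 1:] ^ (i - 1)
            * eulerian_B_maxdrop (n - i) k) + [:-1, 1:] ^ j * U (Suc j)" if "j \<le> k + 1" for j
    using that
  proof (induction j)
    case (Suc j)
    then show ?case using step[of "Suc j"] by (simp only: sum.cl_ivl_Suc) (simp add: algebra_simps)
  qed simp
  \<comment> \<open>A negative last entry would require n \<le> k, so the last entry is positive and
    the drop bound applies to it.\<close>
  have "\<pi> (int n) \<ge> int n - int k" if "\<pi> \<in> signed_perms_maxdrop n k" for \<pi>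
  proof -
    have s: "\<pi> \<in> signed_perms n" using that by (simp add: signed_perms_maxdrop_def)
    have "\<pi> (int n) \<noteq> 0" by (rule signed_perms_nonzero[OF s]) (use assms in simp)
    moreover have "int n \<in> {1..int n}" using assms by auto
    ultimately show ?thesis using that assms unfolding mem_signed_perms_maxdrop_iff
      by (smt (verit) of_nat_le_iff of_nat_add of_nat_1)
  qed
  then have "decreasing_end k 1 n (k + 1) = signed_perms_maxdrop n k"
    by (auto simp: decreasing_end_def)
  then have "eulerian_B_maxdrop n k = U 1" by (simp add: U_def eulerian_B_maxdrop_def)
  moreover have "U (Suc (k + 1)) = 0" using decreasing_end_empty[OF assms] by (simp add: U_def)
  ultimately show ?thesis using tele[of "k + 1"] by simp
qed

section \<open>The generating function\<close>

text \<open>After multiplication by the denominator, the coefficients beyond degree k vanish by the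
  recurrence, and those up to k are exactly the ones that the numerator lists.\<close>

lemma fps_quotient_of_recurrence:
  fixes b :: "nat \<Rightarrow> 'a::comm_ring_1" and c :: "nat \<Rightarrow> 'a"
  assumes rec: "\<And>n. n \<ge> k + 1 \<Longrightarrow> b n = (\<Sum>i = 1..k + 1. c i * b (n - i))"
  shows "Abs_fps b = fps_quotient
     (fps_const (b 0) + (\<Sum>t = 1..k. fps_const (b t - (\<Sum>i = 1..t. c i * b (t - i))) * fps_X ^ t))
     (1 - (\<Sum>i = 1..k + 1. fps_const (c i) * fps_X ^ i))"
proof -
  let ?D = "1 - (\<Sum>i = 1..k + 1. fps_const (c i) * fps_X ^ i)"
  let ?N = "fps_const (b 0) + (\<Sum>t = 1..k. fps_const (b t - (\<Sum>i = 1..t. c i * b (t - i))) * fps_X ^ t)"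
  have "?D $ 0 = 1" by (simp add: fps_sum_nth)
  moreover have "Abs_fps b * ?D = ?N"
  proof (rule fps_ext)
    fix n
    have "(Abs_fps b * (fps_const (c i) * fps_X ^ i)) $ n = (if n < i then 0 else c i * b (n - i))" for i
    proof -
      have *: "Abs_fps b * (fps_const (c i) * fps_X ^ i) = fps_const (c i) * (fps_X ^ i * Abs_fps b)"
        by (simp add: mult_ac)
      show ?thesis unfolding * by (simp add: fps_X_power_mult_nth)
    qed
    then have "(Abs_fps b * ?D) $ n = b n - (\<Sum>i = 1..k + 1. if n < i then 0 else c i * b (n - i))"
      by (simp add: right_diff_distrib sum_distrib_left fps_sum_nth del: sum.cl_ivl_Suc)
    \<comment> \<open>Truncating at \<open>min n (k + 1)\<close> serves both cases below: the sum
      stops at n in the initial range and at k + 1 where the recurrence holds.\<close>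
    also have "(\<Sum>i = 1..k + 1. if n < i then 0 else c i * b (n - i))
         = (\<Sum>i = 1..min n (k + 1). c i * b (n - i))"
      by (rule sum.mono_neutral_cong_right) auto
    also have "b n - \<dots> = ?N $ n"
    proof -
      have "?N $ n = (if n = 0 then b 0 else 0)
          + (\<Sum>t = 1..k. if t = n then b n - (\<Sum>i = 1..n. c i * b (n - i)) else 0)"
        by (simp only: fps_add_nth fps_nth_fps_const fps_sum_nth fps_mult_left_const_nth fps_X_power_nth)
          (intro arg_cong2[where f="(+)"] sum.cong refl, auto)
      also have "\<dots> = b n - (\<Sum>i = 1..min n (k + 1). c i * b (n - i))"
      proof (cases "n \<le> k")
        case True
        then show ?thesis by (cases "n = 0") (simp_all add: min_def)
      next
        case False
        then have "min n (k + 1) = k + 1" by simp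
        then show ?thesis using rec[of n] False by (simp del: sum.cl_ivl_Suc)
      qed
      finally show ?thesis ..
    qed
    finally show "(Abs_fps b * ?D) $ n = ?N $ n" .
  qed
  ultimately show ?thesis by (simp only: fps_quotient_unique)
qed

theorem theorem1p6:
  fixes k :: nat
  shows
    "(\<forall>n::nat. eulerian_B_maxdrop (n + k + 1) k =
        (\<Sum>i = 1..k + 1. of_nat ((k + 1) choose i) * [:-1, 1:] ^ (i - 1)
            * eulerian_B_maxdrop (n + k + 1 - i) k))
     \<and> (\<forall>i\<le>k. eulerian_B_maxdrop i k = eulerian_B i)
     \<and> Abs_fps (\<lambda>n. eulerian_B_maxdrop n k) =
        fps_quotient
          (1 + (\<Sum>t = 1..k.
             fps_const (eulerian_B t
               - (\<Sum>i = 1..t. of_nat ((k + 1) choose i) * [:-1, 1:] ^ (i - 1) * eulerian_B (t - i)))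
             * fps_X ^ t))
          (1 - (\<Sum>i = 1..k + 1.
             of_nat ((k + 1) choose i) * fps_X ^ i * fps_const ([:-1, 1:] ^ (i - 1))))"
proof (intro conjI allI impI)
  fix n
  show "eulerian_B_maxdrop (n + k + 1) k =
        (\<Sum>i = 1..k + 1. of_nat ((k + 1) choose i) * [:-1, 1:] ^ (i - 1)
            * eulerian_B_maxdrop (n + k + 1 - i) k)"
    by (rule eulerian_B_maxdrop_recurrence) simp
next
  show small: "eulerian_B_maxdrop i k = eulerian_B i" if "i \<le> k" for i
    using that by (simp add: eulerian_B_maxdrop_def eulerian_B_def signed_perms_maxdrop_small)
  let ?c = "\<lambda>i. of_nat ((k + 1) choose i) * [:-1, 1:] ^ (i - 1) :: int poly"
  let ?b = "\<lambda>n. eulerian_B_maxdrop n k"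
  have "{\<pi>. \<pi> permutes {0::int}} = {id}" by (auto simp: permutes_sing)
  then have "signed_perms 0 = {id}" by (auto simp: signed_perms_def)
  then have b0: "fps_const (?b 0) = 1"
    by (simp add: small eulerian_B_def des_B_def)
  \<comment> \<open>Only indices up to k occur in the numerator, so the initial conditions replace
    every term.\<close>
  have num: "(\<Sum>t = 1..k. fps_const (?b t - (\<Sum>i = 1..t. ?c i * ?b (t - i))) * fps_X ^ t)
     = (\<Sum>t = 1..k. fps_const (eulerian_B t - (\<Sum>i = 1..t. ?c i * eulerian_B (t - i))) * fps_X ^ t)"
    by (intro sum.cong refl arg_cong2[where f="(*)"] arg_cong[where f=fps_const] arg_cong2[where f="(-)"])
      (auto simp: small)
  have den: "(\<Sum>i = 1..k + 1. fps_const (?c i) * fps_X ^ i)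
     = (\<Sum>i = 1..k + 1. of_nat ((k + 1) choose i) * fps_X ^ i * fps_const ([:-1, 1:] ^ (i - 1)))"
    by (intro sum.cong refl) (simp add: fps_of_nat[symmetric] mult_ac flip: fps_const_mult)
  show "Abs_fps ?b = fps_quotient
          (1 + (\<Sum>t = 1..k.
             fps_const (eulerian_B t
               - (\<Sum>i = 1..t. of_nat ((k + 1) choose i) * [:-1, 1:] ^ (i - 1) * eulerian_B (t - i)))
             * fps_X ^ t))
          (1 - (\<Sum>i = 1..k + 1.
             of_nat ((k + 1) choose i) * fps_X ^ i * fps_const ([:-1, 1:] ^ (i - 1))))"
    using fps_quotient_of_recurrence[of k ?b ?c, OF eulerian_B_maxdrop_recurrence]
    unfolding b0 num den .
qed

end
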